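(* Let $\mu$ be a finite, positive Borel measure on $[0,1]$ and fix $1\leq p\leq\infty$. Suppose that $\mu$ has no Dirac masses at $0$ or $1$, i.e. $\mu(\{0\})=\mu(\{1\})=0$. Then the matrix $\mathcal{C}^{\mu}$ is bounded as an operator from $\ell^p$ to itself if and only if $$\mathcal{N}^{\mu}_{p}:=\int_0^1\frac{1}{(1-t)^{1-\frac1p}\,t^{\frac1p}}\,\mathrm{d}\mu(t)<\infty,$$ where for $p=\infty$ the integral is understood as $\int_0^1\frac{1}{1-t}\,\mathrm{d}\mu(t)$. Moreover, if that is the case, the operator norm of $\mathcal{C}^{\mu}$ on $\ell^p$ equals $\mathcal{N}^{\mu}_{p}$.
   Context: For a finite, positive Borel measure $\mu$ on $[0,1]$, the generalized Hilbert matrix $\mathcal{C}^{\mu}=(\mathcal{C}^{\mu}_{n,k})_{n,k\geq 0}$ is defined by $$\mathcal{C}^{\mu}_{n,k}:=\binom{n+k}{k}\int_0^1(1-t)^n t^k\,\mathrm{d}\mu(t),\qquad n,k=0,1,2,\dots$$ It is viewed as an operator on sequences by $(c_k)_{k=0}^{\infty}\mapsto(d_n)_{n=0}^{\infty}$ with $d_n:=\sum_{k=0}^{\infty}\mathcal{C}^{\mu}_{n,k}c_k$. Here $\ell^p$ is the usual space of (real) sequences indexed by $n\geq 0$ with its usual norm. To say that $\mathcal{C}^{\mu}$ is bounded as an operator on $\ell^p$ means that for every $(c_k)\in\ell^p$ the series defining each $d_n$ converges, $(d_n)\in\ell^p$, and the resulting linear map $\ell^p\to\ell^p$ is bounded.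 *)

theory Defs
  imports "HOL-Analysis.Analysis"
begin

text \<open>
  Sequence spaces \<open>\<ell>\<^sup>p\<close> of real sequences with exponent \<open>1 \<le> p \<le> \<infinity>\<close>, the exponent being an
  extended nonnegative real. The norm is only meaningful on members of the space.
\<close>

definition ell :: "ennreal \<Rightarrow> (nat \<Rightarrow> real) set" where
  "ell p = (if p = \<infinity> then {c. bounded (range c)}
            else {c. summable (\<lambda>k. \<bar>c k\<bar> powr enn2real p)})"

definition ell_norm :: "ennreal \<Rightarrow> (nat \<Rightarrow> real) \<Rightarrow> real" where
  "ell_norm p c = (if p = \<infinity> then (SUP k. \<bar>c k\<bar>)
                   else (\<Sum>k. \<bar>c k\<bar> powr enn2real p) powr (1 / enn2real p))"

definition mat_apply :: "(nat \<Rightarrow> nat \<Rightarrow> real) \<Rightarrow> (nat \<Rightarrow> real) \<Rightarrow> nat \<Rightarrow> real" where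
  "mat_apply A c = (\<lambda>n. \<Sum>k. A n k * c k)"

definition ell_bounded :: "ennreal \<Rightarrow> (nat \<Rightarrow> nat \<Rightarrow> real) \<Rightarrow> bool" where
  "ell_bounded p A \<longleftrightarrow>
     (\<forall>c\<in>ell p. (\<forall>n. summable (\<lambda>k. A n k * c k)) \<and> mat_apply A c \<in> ell p) \<and>
     (\<exists>K. \<forall>c\<in>ell p. ell_norm p (mat_apply A c) \<le> K * ell_norm p c)"

text \<open>
  The operator norm in the style of \<^const>\<open>onorm\<close>: the zero sequence contributes \<open>0 / 0 = 0\<close>.
  Meaningful only if \<^const>\<open>ell_bounded\<close> holds, since it is a supremum of reals.
\<close>

definition ell_onorm :: "ennreal \<Rightarrow> (nat \<Rightarrow> nat \<Rightarrow> real) \<Rightarrow> real" where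
  "ell_onorm p A = (SUP c\<in>ell p. ell_norm p (mat_apply A c) / ell_norm p c)"

definition gen_hilbert :: "real measure \<Rightarrow> nat \<Rightarrow> nat \<Rightarrow> real" where
  "gen_hilbert M n k = real ((n + k) choose k) * (LINT t|M. (1 - t) ^ n * t ^ k)"

text \<open>
  The integral takes values in \<open>[0, \<infinity>]\<close>. At the endpoints \<open>t = 0\<close> and \<open>t = 1\<close> the integrand is
  affected by the conventions \<open>0 powr a = 0\<close> and \<open>x / 0 = 0\<close>; this is harmless as long as
  the measure has no point masses there.
\<close>

definition gen_hilbert_const :: "real measure \<Rightarrow> ennreal \<Rightarrow> ennreal" where
  "gen_hilbert_const M p =
     (if p = \<infinity> then \<integral>\<^sup>+ t. ennreal (1 / (1 - t)) \<partial>M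
      else \<integral>\<^sup>+ t. ennreal (1 / ((1 - t) powr (1 - 1 / enn2real p) * t powr (1 / enn2real p))) \<partial>M)"

end

theory Submission imports Defs begin

text \<open>
  The matrix is the superposition, over \<open>t\<close> in \<open>(0, 1)\<close>, of the kernels
  \<open>((n + k) choose k) * (1 - t) ^ n * t ^ k\<close>. By the negative binomial series all rows of such a
  kernel sum to \<open>1 / (1 - t)\<close> and all columns sum to \<open>1 / t\<close>.

  Upper bound. For a nonnegative matrix with these row and column sums the Schur test gives on
  \<open>\<ell>\<^sup>p\<close> the bound \<open>1 / ((1 - t) powr (1 - 1 / p) * t powr (1 / p))\<close>, which is the integrand of the
  constant. Instead of bounding each kernel and integrating the norms by Minkowski's inequality, the
  Schur test is run once for the sum over \<open>k\<close> and the integral over \<open>t\<close> together, with the weight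
  chosen such that rows and columns both carry the mass of the constant (\<open>norm_density_schur\<close>,
  \<open>schur_test\<close>).

  Lower bound. Up to the factor \<open>1 - t\<close>, row \<open>n\<close> of the kernel is a probability distribution that
  concentrates near \<open>k = n * t / (1 - t)\<close>. The kernel therefore acts approximately as
  \<open>1 / (1 - t)\<close> times the dilation by \<open>t / (1 - t)\<close>, for which power sequences are
  eigenvectors: on \<open>(k + 1) powr (- 1 / p)\<close> the eigenvalue is exactly the integrand. The power
  functions are convex, so Jensen's inequality bounds the image from below with no error term
  (\<open>kern_jensen\<close>). That sequence just fails to be in \<open>\<ell>\<^sup>p\<close>, so the exponent is raised to
  \<open>(1 + e) / p\<close>. As \<open>e\<close> tends to 0 the norm of the test sequence blows up, the boundary effects
  become negligible, and the integral over any compact part of \<open>(0, 1)\<close> is bounded by the operator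
  norm (\<open>truncated_weight_le\<close>). Monotone convergence exhausts the interval, up to the two
  end points, which are null sets.

  For \<open>p = \<infinity>\<close> the row sums alone give both bounds, with the constant sequence 1 as the
  extremal one.
\<close>


section \<open>The kernel of a point mass\<close>

lemma negative_binomial_sums:
  fixes t :: real
  assumes "0 \<le> t" "t < 1"
  shows "(\<lambda>k. real ((n + k) choose k) * t ^ k) sums (1 / (1 - t) ^ (n + 1))"
proof -
  have "(\<lambda>k. (- real (n + 1) gchoose k) * (- t) ^ k) sums ((1 + - t) powr (- real (n + 1)))"
    using assms by (intro gen_binomial_real) auto
  moreover have "(- real (n + 1) gchoose k) * (- t) ^ k = real ((n + k) choose k) * t ^ k" for k
  proof -
    have "(- real (n + 1) gchoose k) = (-1) ^ k * real ((n + k) choose k)"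
      unfolding gbinomial_minus by (simp add: binomial_gbinomial add_ac)
    moreover have "(- 1) ^ k * (- t) ^ k = t ^ k"
      by (simp flip: power_mult_distrib)
    ultimately show ?thesis by (simp add: mult_ac)
  qed
  moreover have "(1 + - t) powr (- real (n + 1)) = 1 / (1 - t) ^ (n + 1)"
    using assms by (simp only: powr_minus powr_realpow) (simp add: powr_realpow divide_simps)
  ultimately show ?thesis by simp
qed

text \<open>
  The matrix of a unit point mass at \<open>t\<close>. Times \<open>1 - t\<close>, its row \<open>n\<close> is the negative binomial
  distribution of the number of successes before failure number \<open>n + 1\<close>, when a success has
  probability \<open>t\<close>.
\<close>

definition kern :: "nat \<Rightarrow> nat \<Rightarrow> real \<Rightarrow> real" where
  "kern n k t = real ((n + k) choose k) * (1 - t) ^ n * t ^ k"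

lemma kern_nonneg: "0 \<le> t \<Longrightarrow> t \<le> 1 \<Longrightarrow> 0 \<le> kern n k t"
  by (simp add: kern_def)

lemma kern_measurable [measurable]: "kern n k \<in> borel_measurable borel"
  unfolding kern_def by measurable

lemma kern_row_sums:
  assumes "0 \<le> t" "t < 1"
  shows "(\<lambda>k. kern n k t) sums (1 / (1 - t))"
  using sums_mult[OF negative_binomial_sums[OF assms, of n], of "(1 - t) ^ n"] assms
  by (simp add: kern_def mult_ac)

text \<open>
  The transpose is the kernel at \<open>1 - t\<close>, so this is the row sum with \<open>t\<close> and \<open>1 - t\<close> exchanged.
\<close>

lemma kern_col_sums:
  assumes "0 < t" "t \<le> 1"
  shows "(\<lambda>n. kern n k t) sums (1 / t)"
proof -
  have "(k + n) choose n = (n + k) choose k" for n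
    using binomial_symmetric[of n "k + n"] by (simp add: add_ac)
  then show ?thesis
    using sums_mult[OF negative_binomial_sums[of "1 - t" k], of "t ^ k"] assms
    by (simp add: kern_def mult_ac)
qed

text \<open>
  The mean of the negative binomial distribution, up to the factor \<open>1 - t\<close>: absorbing \<open>k\<close> into
  the binomial coefficient turns row \<open>n\<close> into a multiple of row \<open>n + 1\<close>.
\<close>

lemma kern_row_mean_sums:
  assumes "0 \<le> t" "t < 1"
  shows "(\<lambda>k. real k * kern n k t) sums (real (n + 1) * t / (1 - t) ^ 2)"
proof -
  have shift: "real (Suc k) * kern n (Suc k) t = (real (n + 1) * t / (1 - t)) * kern (Suc n) k t" for k
  proof -
    have "Suc k * ((n + Suc k) choose Suc k) = Suc n * ((Suc n + k) choose k)"
      using Suc_times_binomial_add[of n k] Suc_times_binomial_add[of k n] 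
      by (simp add: add_ac)
    then have eq: "real (Suc k) * real ((n + Suc k) choose Suc k) = real (Suc n) * real ((Suc n + k) choose k)"
      by (simp only: of_nat_mult[symmetric])
    have "real (Suc k) * kern n (Suc k) t
        = (real (Suc k) * real ((n + Suc k) choose Suc k)) * ((1 - t) ^ n * t ^ Suc k)"
      by (simp only: kern_def mult_ac)
    also have "\<dots> = (real (n + 1) * t / (1 - t)) * kern (Suc n) k t"
      unfolding eq using assms by (simp add: kern_def mult_ac del: binomial_Suc_Suc add_Suc)
    finally show ?thesis .
  qed
  have "(\<lambda>k. real (Suc k) * kern n (Suc k) t) sums ((real (n + 1) * t / (1 - t)) * (1 / (1 - t)))"
    unfolding shift by (intro sums_mult kern_row_sums assms)
  then show ?thesis
    using sums_Suc_iff[of "\<lambda>k. real k * kern n k t"] by (simp add: power2_eq_square)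
qed

text \<open>
  Young's inequality with a free parameter \<open>s\<close>. Integrating it and then optimising over \<open>s\<close>
  replaces Hoelder's inequality in the Schur test below.
\<close>

lemma young_scaled:
  fixes q s x :: real
  assumes "1 \<le> q" "0 < s" "0 \<le> x"
  shows "q * s powr (q - 1) * x \<le> x powr q + (q - 1) * s powr q"
proof (cases "x = 0")
  case False
  have "(x powr q) powr (1 / q) * (s powr q) powr (1 - 1 / q) \<le> 1 / q * x powr q + (1 - 1 / q) * s powr q"
    using assms False by (intro Youngs_inequality_0) (auto simp: field_simps)
  moreover have "(x powr q) powr (1 / q) = x" "(s powr q) powr (1 - 1 / q) = s powr (q - 1)"
    using assms False by (auto simp: powr_powr right_diff_distrib)
  ultimately have "q * (x * s powr (q - 1)) \<le> q * (1 / q * x powr q + (1 - 1 / q) * s powr q)"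
    using assms by (intro mult_left_mono) auto
  also have "\<dots> = x powr q + (q - 1) * s powr q"
    using assms by (simp add: field_simps)
  finally show ?thesis by (simp add: mult_ac)
qed (use assms in auto)

text \<open>
  The tangent inequality for \<open>x powr (- a)\<close> at \<open>y\<close>, which reduces to \<open>1 + z \<le> exp z\<close> and
  \<open>ln z \<le> z - 1\<close>. It is the source of the convexity argument in the lower bound.
\<close>

lemma powr_tangent:
  fixes a x y :: real
  assumes "0 \<le> a" "0 < x" "0 < y"
  shows "y powr (- a) * (1 - a * (x / y - 1)) \<le> x powr (- a)"
proof -
  have "1 - a * (x / y - 1) \<le> 1 + (- a) * ln (x / y)"
    using assms ln_le_minus_one[of "x / y"] by (auto intro: mult_left_mono)
  also have "\<dots> \<le> exp ((- a) * ln (x / y))"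
    by (rule exp_ge_add_one_self)
  also have "\<dots> = (x / y) powr (- a)"
    using assms by (simp add: powr_def)
  also have "\<dots> = x powr (- a) / y powr (- a)"
    using assms by (simp add: powr_divide)
  finally show ?thesis
    using assms by (simp add: field_simps)
qed

text \<open>
  Jensen's inequality for the negative binomial distribution and the convex function
  \<open>x powr (- a)\<close>. The tangent is taken at the mean of \<open>k + 1\<close>, which is
  \<open>1 + (n + 1) * t / (1 - t) = (1 + n * t) / (1 - t)\<close>; there the linear term averages to zero.
\<close>

lemma kern_jensen:
  assumes t: "0 < t" "t < 1" and a: "0 \<le> a"
    and sm: "summable (\<lambda>k. kern n k t * real (k + 1) powr (- a))"
  shows "(1 - t) powr (a - 1) * (1 + real n * t) powr (- a)
           \<le> (\<Sum>k. kern n k t * real (k + 1) powr (- a))"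
proof -
  define y where "y = (1 + real n * t) / (1 - t)"
  have y: "y > 0" using t by (auto simp: y_def intro!: divide_pos_pos add_pos_nonneg)
  define g where "g = (\<lambda>k. kern n k t * (y powr (- a) * (1 - a * (real (k + 1) / y - 1))))"
  have "(\<lambda>k. y powr (- a) * (1 + a - a / y) * kern n k t - (y powr (- a) * a / y) * (real k * kern n k t))
      sums (y powr (- a) * (1 + a - a / y) * (1 / (1 - t))
             - (y powr (- a) * a / y) * (real (n + 1) * t / (1 - t) ^ 2))"
    using t by (intro sums_diff sums_mult kern_row_sums kern_row_mean_sums) auto
  also have "(\<lambda>k. y powr (- a) * (1 + a - a / y) * kern n k t - (y powr (- a) * a / y) * (real k * kern n k t)) = g"
    using y by (auto simp: g_def field_simps fun_eq_iff)
  also have "y powr (- a) * (1 + a - a / y) * (1 / (1 - t)) - (y powr (- a) * a / y) * (real (n + 1) * t / (1 - t) ^ 2)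
      = y powr (- a) / (1 - t) * (1 + a - a / y * (1 + real (n + 1) * t / (1 - t)))"
  proof -
    have "Y * (1 + a - b) * z - (Y * b) * (m * z) = Y * z * (1 + a - b * (1 + m))" for Y b m z :: real
      by algebra
    from this[of "y powr (- a)" "a / y" "1 / (1 - t)" "real (n + 1) * t / (1 - t)"]
    show ?thesis by (simp add: power2_eq_square)
  qed
  also have "1 + real (n + 1) * t / (1 - t) = y"
    using t by (simp add: y_def field_simps)
  also have "y powr (- a) / (1 - t) * (1 + a - a / y * y) = y powr (- a) / (1 - t)"
    using y by simp
  also have "y powr (- a) / (1 - t) = (1 - t) powr (a - 1) * (1 + real n * t) powr (- a)"
  proof -
    have "y powr (- a) = (1 + real n * t) powr (- a) / (1 - t) powr (- a)"
      unfolding y_def by (rule powr_divide)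
    then show ?thesis using t by (simp add: powr_diff powr_minus field_simps)
  qed
  finally have g: "g sums ((1 - t) powr (a - 1) * (1 + real n * t) powr (- a))" .
  have "g k \<le> kern n k t * real (k + 1) powr (- a)" for k
    unfolding g_def using t a y by (intro mult_left_mono powr_tangent kern_nonneg) auto
  then show ?thesis
    by (rule sums_le[OF _ g summable_sums[OF sm]])
qed

section \<open>The Schur weight\<close>

text \<open>
  The integrand of the constant for a finite exponent \<open>q\<close>. It is the norm of the kernel at \<open>t\<close>,
  being the geometric mean of the row sum \<open>1 / (1 - t)\<close> and the column sum \<open>1 / t\<close> with the
  exponents \<open>1 - 1 / q\<close> and \<open>1 / q\<close>.
\<close>

definition norm_density :: "real \<Rightarrow> real \<Rightarrow> real" where
  "norm_density q t = 1 / ((1 - t) powr (1 - 1 / q) * t powr (1 / q))"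

lemma norm_density_nonneg: "0 \<le> norm_density q t" by (simp add: norm_density_def)

lemma norm_density_measurable [measurable]: "norm_density q \<in> borel_measurable borel"
  unfolding norm_density_def by measurable

lemma norm_density_pos: "0 < t \<Longrightarrow> t < 1 \<Longrightarrow> 0 < norm_density q t" by (simp add: norm_density_def)

text \<open>
  The balance between the two sides of the Schur test. The rows of the kernel are weighted by
  \<open>u = (1 - t) * norm_density q t\<close>, which gives them mass
  \<open>u / (1 - t) = norm_density q t\<close>. The columns then carry the weight \<open>u powr (1 - q)\<close> and mass
  \<open>u powr (1 - q) / t\<close>, and this is again \<open>norm_density q t\<close>.
\<close>

lemma norm_density_schur:
  assumes "0 < t" "t < 1" "q \<noteq> 0"
  shows "((1 - t) * norm_density q t) powr (1 - q) * (1 / t) = norm_density q t"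
proof -
  have 1: "(1 - t) * norm_density q t = (1 - t) powr (1 / q) * t powr (- 1 / q)"
    using assms by (simp add: norm_density_def powr_diff powr_minus_divide)
  have "((1 - t) * norm_density q t) powr (1 - q) = (1 - t) powr (1 / q - 1) * t powr (1 - 1 / q)"
    unfolding 1 using assms by (simp add: powr_mult powr_powr diff_divide_distrib)
  then show ?thesis
    using assms by (simp add: norm_density_def powr_diff powr_minus_divide)
qed

section \<open>Matrix entries as integrals of the kernel\<close>

locale interior_measure = finite_measure M for M :: "real measure" +
  assumes sets_M: "sets M = sets (restrict_space borel {0..1})"
    and null_0: "emeasure M {0} = 0" and null_1: "emeasure M {1} = 0"
begin

lemma measurable_M [measurable (raw)]:
  "f \<in> borel_measurable borel \<Longrightarrow> f \<in> borel_measurable M"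
  by (subst measurable_cong_sets[OF sets_M refl]) (rule measurable_restrict_space1)

lemma space_M: "space M = {0..1}"
  using sets_eq_imp_space_eq[OF sets_M] by (simp add: space_restrict_space)

lemma AE_interior: "AE t in M. 0 < t \<and> t < 1"
proof -
  have null: "{0} \<in> null_sets M" "{1} \<in> null_sets M"
    using null_0 null_1 by (auto simp: null_sets_def sets_M sets_restrict_space_iff)
  show ?thesis
    using AE_not_in[OF null(1)] AE_not_in[OF null(2)] AE_space by eventually_elim (auto simp: space_M)
qed

lemma gen_hilbert_nonneg: "0 \<le> gen_hilbert M n k"
  unfolding gen_hilbert_def by (intro mult_nonneg_nonneg Bochner_Integration.integral_nonneg) (auto simp: space_M)

lemma ennreal_gen_hilbert: "ennreal (gen_hilbert M n k) = (\<integral>\<^sup>+ t. ennreal (kern n k t) \<partial>M)"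
proof -
  have "integrable M (kern n k)"
  proof (rule integrable_const_bound[of _ "real ((n + k) choose k)"])
    show "AE t in M. norm (kern n k t) \<le> real ((n + k) choose k)"
      by (auto simp: space_M kern_def abs_mult power_abs mult.assoc
          intro!: mult_left_le mult_le_one power_le_one)
  qed measurable
  moreover have "gen_hilbert M n k = (LINT t|M. kern n k t)"
    by (simp add: gen_hilbert_def kern_def mult.assoc)
  ultimately show ?thesis
    by (subst nn_integral_eq_integral) (auto simp: space_M kern_nonneg)
qed

text \<open>
  For nonnegative sequences the sum over \<open>k\<close> and the integral over \<open>t\<close> commute in \<open>[0, \<infinity>]\<close>, so
  that pointwise statements about the kernel carry over to the matrix.
\<close>

lemma nn_integral_row_apply:
  assumes "\<And>k. 0 \<le> c k"
  shows "(\<Sum>k. ennreal (gen_hilbert M n k * c k)) = (\<integral>\<^sup>+ t. (\<Sum>k. ennreal (kern n k t * c k)) \<partial>M)"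
proof -
  have "(\<integral>\<^sup>+ t. (\<Sum>k. ennreal (kern n k t * c k)) \<partial>M) = (\<Sum>k. \<integral>\<^sup>+ t. ennreal (kern n k t * c k) \<partial>M)"
    by (intro nn_integral_suminf) measurable
  also have "\<dots> = (\<Sum>k. ennreal (gen_hilbert M n k * c k))"
    using assms by (simp add: ennreal_mult'' nn_integral_multc gen_hilbert_nonneg ennreal_gen_hilbert)
  finally show ?thesis ..
qed

end


section \<open>The upper bound for finite exponents\<close>

lemma kern_row_suminf:
  assumes "0 \<le> t" "t < 1"
  shows "(\<Sum>k. ennreal (kern n k t)) = ennreal (1 / (1 - t))"
  using kern_row_sums[OF assms] assms
  by (intro sums_unique[symmetric]) (auto simp: kern_nonneg)

lemma kern_col_suminf:
  assumes "0 < t" "t \<le> 1"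
  shows "(\<Sum>n. ennreal (kern n k t)) = ennreal (1 / t)"
  using kern_col_sums[OF assms] assms
  by (intro sums_unique[symmetric]) (auto simp: kern_nonneg)

lemma suminf_swap_ennreal:
  fixes f :: "nat \<Rightarrow> nat \<Rightarrow> ennreal"
  shows "(\<Sum>n. \<Sum>k. f n k) = (\<Sum>k. \<Sum>n. f n k)"
  using nn_integral_suminf[of "\<lambda>n. f n" "count_space UNIV"]
  by (simp add: nn_integral_count_space_nat)

context interior_measure
begin

text \<open>
  The right-hand side, up to a constant factor, of Hoelder's inequality for the \<open>q\<close>-th power of
  entry \<open>n\<close> of the image of \<open>c\<close>.
\<close>

abbreviation row_mass :: "real \<Rightarrow> (nat \<Rightarrow> real) \<Rightarrow> nat \<Rightarrow> ennreal" where
  "row_mass q c n \<equiv> \<integral>\<^sup>+ t. (\<Sum>k. ennreal (kern n k t * ((1 - t) * norm_density q t) powr (1 - q) * \<bar>c k\<bar> powr q)) \<partial>M"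

text \<open>
  Young's inequality is applied to \<open>x = \<bar>c k\<bar> / u\<close> with \<open>u = (1 - t) * norm_density q t\<close> and integrated against
  the measure with density \<open>kern n k t * u\<close>, whose total mass over all \<open>k\<close> and \<open>t\<close> is the
  integral of \<open>norm_density q\<close>, for every \<open>n\<close>.
\<close>

lemma row_young:
  assumes q: "1 \<le> q" and s: "0 < s"
  shows "ennreal (q * s powr (q - 1)) * (\<Sum>k. ennreal (gen_hilbert M n k * \<bar>c k\<bar>))
     \<le> row_mass q c n + ennreal ((q - 1) * s powr q) * (\<integral>\<^sup>+ t. ennreal (norm_density q t) \<partial>M)"
proof -
  have "ennreal (q * s powr (q - 1)) * (\<Sum>k. ennreal (gen_hilbert M n k * \<bar>c k\<bar>))
      = (\<integral>\<^sup>+ t. ennreal (q * s powr (q - 1)) * (\<Sum>k. ennreal (kern n k t * \<bar>c k\<bar>)) \<partial>M)"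
    by (subst nn_integral_row_apply) (auto simp: nn_integral_cmult)
  also have "\<dots> \<le> (\<integral>\<^sup>+ t. (\<Sum>k. ennreal (kern n k t * ((1 - t) * norm_density q t) powr (1 - q) * \<bar>c k\<bar> powr q))
                   + ennreal ((q - 1) * s powr q) * ennreal (norm_density q t) \<partial>M)"
  proof (rule nn_integral_mono_AE, rule eventually_mono[OF AE_interior])
    fix t :: real assume "0 < t \<and> t < 1"
    then have t: "0 < t" "t < 1" by auto
    define u where "u = (1 - t) * norm_density q t"
    have u: "u > 0" using t norm_density_pos by (simp add: u_def)
    have "ennreal (q * s powr (q - 1)) * ennreal (kern n k t * \<bar>c k\<bar>)
       \<le> ennreal (kern n k t * u powr (1 - q) * \<bar>c k\<bar> powr q) + ennreal ((q - 1) * s powr q * u) * ennreal (kern n k t)" for k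
    proof -
      have "q * s powr (q - 1) * (\<bar>c k\<bar> / u) \<le> (\<bar>c k\<bar> / u) powr q + (q - 1) * s powr q"
        using q s u by (intro young_scaled) auto
      then have "kern n k t * u * (q * s powr (q - 1) * (\<bar>c k\<bar> / u))
          \<le> kern n k t * u * ((\<bar>c k\<bar> / u) powr q + (q - 1) * s powr q)"
        using t u by (intro mult_left_mono) (auto simp: kern_nonneg)
      moreover have "u * (\<bar>c k\<bar> / u) powr q = u powr (1 - q) * \<bar>c k\<bar> powr q"
        using u by (simp add: powr_divide powr_diff)
      moreover have "kern n k t * u * ((\<bar>c k\<bar> / u) powr q + (q - 1) * s powr q)
          = kern n k t * (u * (\<bar>c k\<bar> / u) powr q) + (q - 1) * s powr q * u * kern n k t"
        by (simp add: algebra_simps)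
      moreover have "kern n k t * u * (q * s powr (q - 1) * (\<bar>c k\<bar> / u)) = q * s powr (q - 1) * (kern n k t * \<bar>c k\<bar>)"
        using u by simp
      ultimately have "q * s powr (q - 1) * (kern n k t * \<bar>c k\<bar>)
          \<le> kern n k t * u powr (1 - q) * \<bar>c k\<bar> powr q + (q - 1) * s powr q * u * kern n k t"
        by (simp add: mult.assoc)
      then show ?thesis
        using q s u t by (simp add: kern_nonneg flip: ennreal_mult ennreal_plus)
    qed
    then have "(\<Sum>k. ennreal (q * s powr (q - 1)) * ennreal (kern n k t * \<bar>c k\<bar>))
        \<le> (\<Sum>k. ennreal (kern n k t * u powr (1 - q) * \<bar>c k\<bar> powr q) + ennreal ((q - 1) * s powr q * u) * ennreal (kern n k t))"
      by (intro suminf_le) auto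
    also have "\<dots> = (\<Sum>k. ennreal (kern n k t * u powr (1 - q) * \<bar>c k\<bar> powr q))
         + ennreal ((q - 1) * s powr q * u) * ennreal (1 / (1 - t))"
      using t by (simp add: suminf_add[symmetric] kern_row_suminf)
    also have "ennreal ((q - 1) * s powr q * u) * ennreal (1 / (1 - t)) = ennreal ((q - 1) * s powr q) * ennreal (norm_density q t)"
      using t q s u by (simp add: u_def norm_density_nonneg flip: ennreal_mult)
    finally show "ennreal (q * s powr (q - 1)) * (\<Sum>k. ennreal (kern n k t * \<bar>c k\<bar>))
       \<le> (\<Sum>k. ennreal (kern n k t * ((1 - t) * norm_density q t) powr (1 - q) * \<bar>c k\<bar> powr q))
                   + ennreal ((q - 1) * s powr q) * ennreal (norm_density q t)"
      by (simp add: u_def)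
  qed
  also have "\<dots> = row_mass q c n + ennreal ((q - 1) * s powr q) * (\<integral>\<^sup>+ t. ennreal (norm_density q t) \<partial>M)"
    by (simp add: nn_integral_add nn_integral_cmult)
  finally show ?thesis .
qed

text \<open>
  After summation over \<open>n\<close> only the column sums of the kernel remain, and \<open>norm_density_schur\<close> turns the
  weight back into \<open>norm_density q\<close>.
\<close>

lemma suminf_row_mass:
  assumes q: "1 \<le> q"
  shows "(\<Sum>n. row_mass q c n) = (\<integral>\<^sup>+ t. ennreal (norm_density q t) \<partial>M) * (\<Sum>k. ennreal (\<bar>c k\<bar> powr q))"
proof -
  have "(\<Sum>n. row_mass q c n)
      = (\<integral>\<^sup>+ t. (\<Sum>n. \<Sum>k. ennreal (kern n k t * ((1 - t) * norm_density q t) powr (1 - q) * \<bar>c k\<bar> powr q)) \<partial>M)"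
    by (intro nn_integral_suminf[symmetric]) measurable
  also have "\<dots> = (\<integral>\<^sup>+ t. ennreal (norm_density q t) * (\<Sum>k. ennreal (\<bar>c k\<bar> powr q)) \<partial>M)"
  proof (rule nn_integral_cong_AE, rule eventually_mono[OF AE_interior])
    fix t :: real assume "0 < t \<and> t < 1"
    then have t: "0 < t" "t < 1" by auto
    let ?v = "((1 - t) * norm_density q t) powr (1 - q)"
    have "(\<Sum>n. \<Sum>k. ennreal (kern n k t * ?v * \<bar>c k\<bar> powr q))
        = (\<Sum>k. \<Sum>n. ennreal (kern n k t) * ennreal (?v * \<bar>c k\<bar> powr q))"
      using t by (subst suminf_swap_ennreal) (simp add: kern_nonneg mult.assoc flip: ennreal_mult)
    also have "\<dots> = (\<Sum>k. ennreal (1 / t) * ennreal (?v * \<bar>c k\<bar> powr q))"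
      using t by (simp add: kern_col_suminf)
    also have "\<dots> = (\<Sum>k. ennreal (?v * (1 / t)) * ennreal (\<bar>c k\<bar> powr q))"
      using t by (simp add: mult_ac flip: ennreal_mult)
    also have "\<dots> = ennreal (norm_density q t) * (\<Sum>k. ennreal (\<bar>c k\<bar> powr q))"
      using t q by (simp only: norm_density_schur[of t q] ennreal_suminf_cmult)
    finally show "(\<Sum>n. \<Sum>k. ennreal (kern n k t * ?v * \<bar>c k\<bar> powr q))
        = ennreal (norm_density q t) * (\<Sum>k. ennreal (\<bar>c k\<bar> powr q))" .
  qed
  also have "\<dots> = (\<integral>\<^sup>+ t. ennreal (norm_density q t) \<partial>M) * (\<Sum>k. ennreal (\<bar>c k\<bar> powr q))"
    by (simp add: nn_integral_multc)
  finally show ?thesis .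
qed

text \<open>
  Stated for every \<open>K > 0\<close> above the integral of the weight, and not for the integral itself, since
  the optimal parameter \<open>s = d n / K\<close> in Young's inequality needs a nonzero denominator.
\<close>

lemma schur_test:
  assumes q: "1 \<le> q" and K: "0 < K" and N: "(\<integral>\<^sup>+ t. ennreal (norm_density q t) \<partial>M) \<le> ennreal K"
    and c: "summable (\<lambda>k. \<bar>c k\<bar> powr q)"
  shows "summable (\<lambda>k. gen_hilbert M n k * c k)"
    and "summable (\<lambda>n. \<bar>mat_apply (gen_hilbert M) c n\<bar> powr q)"
    and "(\<Sum>n. \<bar>mat_apply (gen_hilbert M) c n\<bar> powr q) \<le> K powr q * (\<Sum>k. \<bar>c k\<bar> powr q)"
proof -
  define S where "S = (\<Sum>k. \<bar>c k\<bar> powr q)"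
  have S0: "S \<ge> 0" unfolding S_def by (intro suminf_nonneg c) auto
  have S: "(\<Sum>k. ennreal (\<bar>c k\<bar> powr q)) = ennreal S"
    unfolding S_def by (intro suminf_ennreal2 c) auto
  have tot: "(\<Sum>n. row_mass q c n) \<le> ennreal (K * S)"
    unfolding suminf_row_mass[OF q] S using N K S0 by (simp add: ennreal_mult mult_right_mono)
  have row_fin: "row_mass q c n < \<infinity>" for n
  proof -
    have "row_mass q c n \<le> (\<Sum>n. row_mass q c n)"
      using sum_le_suminf[OF summableI, of "{n}" "row_mass q c"] by simp
    also note tot
    finally show ?thesis by (simp add: le_less_trans)
  qed
  define P where "P n = enn2real (row_mass q c n)" for n
  have P: "row_mass q c n = ennreal (P n)" for n
    using row_fin[of n] by (simp add: P_def)
  have P0: "P n \<ge> 0" for n by (simp add: P_def)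
  (* Taking s = 1 in this family shows that the rows converge; s = d n / K gives the sharp bound. *)
  have yng: "ennreal (q * s powr (q - 1)) * (\<Sum>k. ennreal (gen_hilbert M n k * \<bar>c k\<bar>))
     \<le> ennreal (P n + (q - 1) * s powr q * K)" if "0 < s" for s n
  proof -
    note row_young[OF q that, of n c]
    also have "row_mass q c n + ennreal ((q - 1) * s powr q) * (\<integral>\<^sup>+ t. ennreal (norm_density q t) \<partial>M)
       \<le> ennreal (P n) + ennreal ((q - 1) * s powr q) * ennreal K"
      unfolding P using N by (intro add_left_mono mult_left_mono) auto
    also have "\<dots> = ennreal (P n + (q - 1) * s powr q * K)"
      using q K P0 by (simp flip: ennreal_mult ennreal_plus)
    finally show ?thesis .
  qed
  have sm: "summable (\<lambda>k. gen_hilbert M n k * \<bar>c k\<bar>)" for n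
  proof -
    have "ennreal q * (\<Sum>k. ennreal (gen_hilbert M n k * \<bar>c k\<bar>)) < \<infinity>"
      using yng[of 1 n] by (simp add: le_less_trans)
    then have "(\<Sum>k. ennreal (gen_hilbert M n k * \<bar>c k\<bar>)) \<noteq> \<infinity>"
      using q by (auto simp: ennreal_mult_top ennreal_mult_less_top)
    then show ?thesis
      by (intro summable_suminf_not_top) (auto simp: gen_hilbert_nonneg)
  qed
  define d where "d n = (\<Sum>k. gen_hilbert M n k * \<bar>c k\<bar>)" for n
  have d0: "d n \<ge> 0" for n unfolding d_def by (intro suminf_nonneg sm) (auto simp: gen_hilbert_nonneg)
  have d: "(\<Sum>k. ennreal (gen_hilbert M n k * \<bar>c k\<bar>)) = ennreal (d n)" for n
    unfolding d_def by (intro suminf_ennreal2 sm) (auto simp: gen_hilbert_nonneg)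
  have dP: "d n powr q \<le> K powr (q - 1) * P n" for n
  proof (cases "d n = 0")
    case False
    with d0[of n] have dn: "d n > 0" by simp
    define s where "s = d n / K"
    have s: "s > 0" "d n = K * s" using dn K by (auto simp: s_def)
    have "ennreal (q * s powr (q - 1) * d n) \<le> ennreal (P n + (q - 1) * s powr q * K)"
      using yng[OF s(1), of n] q d0[of n] unfolding d
      by (simp flip: ennreal_mult del: ennreal_plus)
    then have "q * s powr (q - 1) * d n \<le> P n + (q - 1) * s powr q * K"
      using q P0[of n] K by (subst (asm) ennreal_le_iff) auto
    moreover have "s powr (q - 1) * s = s powr q"
      using s by (simp add: powr_diff)
    ultimately have "K * s powr q \<le> P n"
      by (simp add: s(2) algebra_simps)
    then have "K powr (q - 1) * (K * s powr q) \<le> K powr (q - 1) * P n"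
      by (intro mult_left_mono) auto
    then show ?thesis
      using K s by (simp add: s(2) powr_mult powr_diff)
  qed (use P0 in auto)
  have dn_sum: "(\<Sum>n. ennreal (d n powr q)) \<le> ennreal (K powr q * S)"
  proof -
    have "(\<Sum>n. ennreal (d n powr q)) \<le> (\<Sum>n. ennreal (K powr (q - 1)) * row_mass q c n)"
      using dP by (intro suminf_le) (auto simp: P P0 simp flip: ennreal_mult)
    also have "\<dots> \<le> ennreal (K powr (q - 1)) * ennreal (K * S)"
      using tot by (simp add: mult_left_mono)
    also have "\<dots> = ennreal (K powr q * S)"
      using K S0 by (simp add: powr_diff flip: ennreal_mult)
    finally show ?thesis .
  qed
  have dsm: "summable (\<lambda>n. d n powr q)"
    using dn_sum by (intro summable_suminf_not_top) (auto simp: top_unique)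
  have dle: "(\<Sum>n. d n powr q) \<le> K powr q * S"
    using dn_sum S0 dsm by (simp add: suminf_ennreal2)
  show sm': "summable (\<lambda>k. gen_hilbert M n k * c k)" for n
    using sm[of n] by (intro summable_rabs_cancel[of "\<lambda>k. gen_hilbert M n k * c k"])
      (simp add: abs_mult gen_hilbert_nonneg)
  have "\<bar>mat_apply (gen_hilbert M) c n\<bar> \<le> d n" for n
    unfolding mat_apply_def d_def using summable_rabs[of "\<lambda>k. gen_hilbert M n k * c k"] sm[of n]
    by (simp add: abs_mult gen_hilbert_nonneg)
  then have le: "\<bar>mat_apply (gen_hilbert M) c n\<bar> powr q \<le> d n powr q" for n
    using q by (intro powr_mono2) auto
  show asm: "summable (\<lambda>n. \<bar>mat_apply (gen_hilbert M) c n\<bar> powr q)"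
    by (rule summable_comparison_test'[OF dsm]) (use le in auto)
  show "(\<Sum>n. \<bar>mat_apply (gen_hilbert M) c n\<bar> powr q) \<le> K powr q * (\<Sum>k. \<bar>c k\<bar> powr q)"
    using suminf_le[OF le asm dsm] dle by (simp add: S_def)
qed

end


section \<open>The lower bound for finite exponents\<close>

lemma summable_shifted_powr: "0 < e \<Longrightarrow> summable (\<lambda>n. real (n + 1) powr - (1 + e))"
  using summable_real_powr_iff[of "- (1 + e)"] summable_Suc_iff[of "\<lambda>n. real n powr - (1 + e)"]
  by simp

text \<open>
  The test sequences used below have \<open>q\<close>-norms that blow up as \<open>e\<close> tends to 0, because the
  harmonic series diverges. This makes any fixed number of initial terms negligible.
\<close>

lemma zeta_at_right_1:
  "filterlim (\<lambda>e. \<Sum>n. real (n + 1) powr - (1 + e)) at_top (at_right 0)"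
  unfolding filterlim_at_top
proof
  fix Z :: real
  have "\<exists>N. Z < (\<Sum>n<N. real (n + 1) powr - (1 + 0))"
  proof (rule ccontr)
    assume "\<not> ?thesis"
    then have "summable (\<lambda>n. real (n + 1) powr - (1 + 0))"
      by (intro summableI_nonneg_bounded[of _ Z]) (auto simp: not_less)
    then show False
      using summable_Suc_iff[of "\<lambda>n. real n powr - 1"] summable_real_powr_iff[of "- 1"] by simp
  qed
  then obtain N where N: "Z < (\<Sum>n<N. real (n + 1) powr - (1 + 0))" by blast
  have "((\<lambda>e. \<Sum>n<N. real (n + 1) powr - (1 + e)) \<longlongrightarrow> (\<Sum>n<N. real (n + 1) powr - (1 + 0))) (at_right 0)"
    by (intro tendsto_intros) auto
  then have "\<forall>\<^sub>F e in at_right 0. Z < (\<Sum>n<N. real (n + 1) powr - (1 + e))"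
    using N by (rule order_tendstoD)
  moreover have "\<forall>\<^sub>F e in at_right 0. (0::real) < e"
    by (rule eventually_at_right_less)
  ultimately show "\<forall>\<^sub>F e in at_right 0. Z \<le> (\<Sum>n. real (n + 1) powr - (1 + e))"
  proof eventually_elim
    case (elim e)
    have "(\<Sum>n<N. real (n + 1) powr - (1 + e)) \<le> (\<Sum>n. real (n + 1) powr - (1 + e))"
      by (intro sum_le_suminf summable_shifted_powr elim) auto
    with elim show ?case by linarith
  qed
qed

text \<open>
  Compares the Jensen bound with a product of a function of \<open>n\<close> and the weight. Away from the end
  points, \<open>1 + n * t \<le> t * (n + m)\<close> separates \<open>n\<close> from \<open>t\<close>, and the excess \<open>e / q\<close> of the exponent
  over \<open>1 / q\<close> costs only the factor \<open>m powr (- (e / q))\<close>, which tends to 1 with \<open>e\<close>.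
\<close>

lemma norm_density_test_bound:
  assumes q: "0 < q" and e: "0 \<le> e" and m: "0 < m"
    and t: "1 / real m \<le> t" "t \<le> 1 - 1 / real m" "t < 1"
  shows "real (n + m) powr (- ((1 + e) / q)) * real m powr (- (e / q)) * norm_density q t
      \<le> (1 - t) powr ((1 + e) / q - 1) * (1 + real n * t) powr (- ((1 + e) / q))"
proof -
  define a where "a = (1 + e) / q"
  have a: "0 \<le> a" using q e by (simp add: a_def)
  have t0: "0 < t" using t(1) m by (smt (verit) divide_pos_pos of_nat_0_less_iff)
  have "real m powr (- (e / q)) = (1 / real m) powr (e / q)"
    using m by (simp add: powr_minus powr_divide divide_simps)
  also have "\<dots> \<le> (1 - t) powr (e / q)"
    using t e q by (intro powr_mono2) auto
  finally have 1: "real m powr (- (e / q)) \<le> (1 - t) powr (e / q)" .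
  have 2: "t powr (- (1 / q)) \<le> t powr (- a)"
    using t0 t q e by (intro powr_mono') (auto simp: a_def field_simps)
  have norm_density: "norm_density q t = (1 - t) powr (1 / q - 1) * t powr (- (1 / q))"
    using t0 t by (simp add: norm_density_def powr_diff powr_minus_divide)
  have "real (n + m) powr (- a) * real m powr (- (e / q)) * norm_density q t
     = real (n + m) powr (- a) * ((1 - t) powr (1 / q - 1) * real m powr (- (e / q))) * t powr (- (1 / q))"
    unfolding norm_density by (simp add: mult_ac)
  also have "\<dots> \<le> real (n + m) powr (- a) * ((1 - t) powr (1 / q - 1) * (1 - t) powr (e / q)) * t powr (- a)"
    by (intro mult_mono 1 2 mult_nonneg_nonneg order_refl) auto
  also have "(1 - t) powr (1 / q - 1) * (1 - t) powr (e / q) = (1 - t) powr (a - 1)"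
    by (simp add: a_def add_divide_distrib algebra_simps flip: powr_add)
  also have "real (n + m) powr (- a) * (1 - t) powr (a - 1) * t powr (- a)
      = (1 - t) powr (a - 1) * (t * real (n + m)) powr (- a)"
    using t0 by (simp add: powr_mult)
  also have "\<dots> \<le> (1 - t) powr (a - 1) * (1 + real n * t) powr (- a)"
  proof (intro mult_left_mono powr_mono2')
    have "1 \<le> t * real m" using t(1) m by (simp add: field_simps)
    then show "1 + real n * t \<le> t * real (n + m)" by (simp add: algebra_simps)
    show "0 < 1 + real n * t" using t0 by (intro add_pos_nonneg) auto
  qed (use a in auto)
  finally show ?thesis by (simp add: a_def)
qed

context interior_measure
begin

text \<open>
  Jensen's inequality for each kernel, integrated over \<open>t\<close>. The factor that depends on \<open>n\<close> is a
  shift of the test sequence itself, which is what makes that sequence almost an eigenvector.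
\<close>

lemma row_test_bound:
  assumes q: "0 < q" and e: "0 < e" and m: "0 < m"
    and sm: "summable (\<lambda>k. gen_hilbert M n k * real (k + 1) powr (- ((1 + e) / q)))"
  shows "ennreal (real (n + m) powr (- ((1 + e) / q)) * real m powr (- (e / q)))
           * (\<integral>\<^sup>+ t. ennreal (norm_density q t) * indicator {1 / real m..1 - 1 / real m} t \<partial>M)
      \<le> ennreal (\<Sum>k. gen_hilbert M n k * real (k + 1) powr (- ((1 + e) / q)))"
    (is "ennreal ?C * ?W \<le> _")
proof -
  define a where "a = (1 + e) / q"
  have a: "0 < a" using q e by (simp add: a_def)
  have "ennreal ?C * ?W = (\<integral>\<^sup>+ t. ennreal ?C * (ennreal (norm_density q t) * indicator {1 / real m..1 - 1 / real m} t) \<partial>M)"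
    by (intro nn_integral_cmult[symmetric]) measurable
  also have "\<dots> \<le> (\<integral>\<^sup>+ t. (\<Sum>k. ennreal (kern n k t * real (k + 1) powr (- a))) \<partial>M)"
  proof (rule nn_integral_mono_AE, rule eventually_mono[OF AE_interior])
    fix t :: real assume "0 < t \<and> t < 1"
    then have t: "0 < t" "t < 1" by auto
    have ks: "summable (\<lambda>k. kern n k t * real (k + 1) powr (- a))"
    proof (rule summable_comparison_test'[OF sums_summable[OF kern_row_sums]])
      fix k
      have "real (k + 1) powr (- a) \<le> 1 powr (- a)"
        using a by (intro powr_mono2') auto
      then show "norm (kern n k t * real (k + 1) powr (- a)) \<le> kern n k t"
        using t kern_nonneg[of t n k] by (simp add: abs_mult mult_left_le)
    qed (use t in auto)
    show "ennreal ?C * (ennreal (norm_density q t) * indicator {1 / real m..1 - 1 / real m} t)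
        \<le> (\<Sum>k. ennreal (kern n k t * real (k + 1) powr (- a)))"
    proof (cases "t \<in> {1 / real m..1 - 1 / real m}")
      case True
      have "?C * norm_density q t \<le> (1 - t) powr (a - 1) * (1 + real n * t) powr (- a)"
        using True t q e m unfolding a_def by (intro norm_density_test_bound) auto
      also have "\<dots> \<le> (\<Sum>k. kern n k t * real (k + 1) powr (- a))"
        using t a ks by (intro kern_jensen) auto
      finally have "ennreal (?C * norm_density q t) \<le> ennreal (\<Sum>k. kern n k t * real (k + 1) powr (- a))"
        by (rule ennreal_leI)
      also have "\<dots> = (\<Sum>k. ennreal (kern n k t * real (k + 1) powr (- a)))"
        using t by (intro suminf_ennreal2[symmetric] ks) (simp add: kern_nonneg)
      finally show ?thesis using True by (simp add: ennreal_mult norm_density_nonneg)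
    qed simp
  qed
  also have "\<dots> = (\<Sum>k. ennreal (gen_hilbert M n k * real (k + 1) powr (- a)))"
    by (intro nn_integral_row_apply[symmetric]) auto
  also have "\<dots> = ennreal (\<Sum>k. gen_hilbert M n k * real (k + 1) powr (- a))"
    using sm by (intro suminf_ennreal2) (auto simp: a_def gen_hilbert_nonneg)
  finally show ?thesis by (simp add: a_def)
qed

text \<open>
  The test sequences \<open>c e\<close> are almost eigenvectors: with \<open>a = (1 + e) / q\<close>, row \<open>n\<close> of the image is at least
  \<open>(n + m) powr (- a)\<close> times a constant, so the \<open>q\<close>-th powers of the norms are compared through
  \<open>S\<close> and its tail, which differ by at most \<open>m\<close>. Since \<open>S\<close> tends to infinity as \<open>e\<close> tends
  to 0, the limit leaves just the truncated weight.
\<close>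

lemma truncated_weight_le:
  assumes q: "1 \<le> q" and L: "0 \<le> L" and m: "0 < m"
    and sm: "\<And>c n. summable (\<lambda>k. \<bar>c k\<bar> powr q) \<Longrightarrow> summable (\<lambda>k. gen_hilbert M n k * c k)"
    and smp: "\<And>c. summable (\<lambda>k. \<bar>c k\<bar> powr q) \<Longrightarrow> summable (\<lambda>n. \<bar>mat_apply (gen_hilbert M) c n\<bar> powr q)"
    and bd: "\<And>c. summable (\<lambda>k. \<bar>c k\<bar> powr q) \<Longrightarrow> 0 < (\<Sum>k. \<bar>c k\<bar> powr q) \<Longrightarrow>
       (\<Sum>n. \<bar>mat_apply (gen_hilbert M) c n\<bar> powr q) \<le> L * (\<Sum>k. \<bar>c k\<bar> powr q)"
  shows "(\<integral>\<^sup>+ t. ennreal (norm_density q t) * indicator {1 / real m..1 - 1 / real m} t \<partial>M) \<le> ennreal (L powr (1 / q))"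
    (is "?W \<le> _")
proof -
  define c :: "real \<Rightarrow> nat \<Rightarrow> real" where "c e k = real (k + 1) powr (- ((1 + e) / q))" for e k
  have cq: "\<bar>c e k\<bar> powr q = real (k + 1) powr - (1 + e)" for e k
  proof -
    have "- ((1 + e) / q) * q = - (1 + e)" using q by simp
    then show ?thesis by (simp only: c_def powr_powr abs_of_nonneg[OF powr_ge_zero])
  qed
  have csm: "summable (\<lambda>k. \<bar>c e k\<bar> powr q)" if "0 < e" for e
    unfolding cq using that by (rule summable_shifted_powr)
  define S where "S e = (\<Sum>n. real (n + 1) powr - (1 + e))" for e
  have S1: "1 \<le> S e" if "0 < e" for e
    using sum_le_suminf[OF summable_shifted_powr[OF that], of "{0}"] by (simp add: S_def)
  have row: "ennreal (real (n + m) powr (- ((1 + e) / q)) * real m powr (- (e / q))) * ?W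
      \<le> ennreal (mat_apply (gen_hilbert M) (c e) n)" if "0 < e" for e n
    using row_test_bound[of q e m n] sm[OF csm[OF that]] q m that
    by (simp add: mat_apply_def c_def)
  have "?W < \<infinity>"
  proof -
    have "ennreal (real (0 + m) powr (- ((1 + 1) / q)) * real m powr (- (1 / q))) * ?W < \<infinity>"
      using row[of 1 0] by (simp add: le_less_trans)
    then show ?thesis using m by (auto simp: ennreal_mult_less_top)
  qed
  then obtain w where w: "0 \<le> w" "?W = ennreal w"
    by (cases ?W) auto
  have "real m powr (- e) * w powr q * (1 - real m / S e) \<le> L" if e: "0 < e" for e
  proof -
    let ?f = "\<lambda>n. real (n + 1) powr - (1 + e)"
    have tailsm: "summable (\<lambda>n. ?f (n + (m - 1)))"
      using summable_shifted_powr[OF e] by (rule summable_ignore_initial_segment)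
    have tail: "?f (n + (m - 1)) = real (n + m) powr - (1 + e)" for n
      using m by (simp add: of_nat_diff)
    have "S e = (\<Sum>n. ?f (n + (m - 1))) + (\<Sum>n<m - 1. ?f n)"
      unfolding S_def by (intro suminf_split_initial_segment summable_shifted_powr e)
    also have "(\<Sum>n<m - 1. ?f n) \<le> (\<Sum>n<m - 1. 1)"
    proof (rule sum_mono)
      fix n
      have "?f n \<le> 1 powr - (1 + e)" using e by (intro powr_mono2') auto
      then show "?f n \<le> 1" by simp
    qed
    finally have tail_ge: "S e - real m \<le> (\<Sum>n. ?f (n + (m - 1)))"
      by simp
    have "real m powr (- e) * w powr q * ?f (n + (m - 1)) \<le> \<bar>mat_apply (gen_hilbert M) (c e) n\<bar> powr q" for n
    proof -
      let ?C = "real (n + m) powr (- ((1 + e) / q)) * real m powr (- (e / q))"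
      have "ennreal (?C * w) \<le> ennreal (mat_apply (gen_hilbert M) (c e) n)"
        using row[OF e, of n] w by (simp add: ennreal_mult)
      then have "?C * w \<le> \<bar>mat_apply (gen_hilbert M) (c e) n\<bar>"
        by (smt (verit) ennreal_le_iff2)
      then have "(?C * w) powr q \<le> \<bar>mat_apply (gen_hilbert M) (c e) n\<bar> powr q"
        using q w by (intro powr_mono2) auto
      also have "(?C * w) powr q = real m powr (- e) * w powr q * ?f (n + (m - 1))"
      proof -
        have "- ((1 + e) / q) * q = - (1 + e)" "- (e / q) * q = - e" using q by simp_all
        then have "?C powr q = real (n + m) powr - (1 + e) * real m powr - e"
          by (simp only: powr_mult powr_powr)
        then have "(?C * w) powr q = real (n + m) powr - (1 + e) * real m powr - e * w powr q"
          by (simp only: powr_mult)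
        then show ?thesis unfolding tail by (simp only: mult_ac)
      qed
      finally show ?thesis .
    qed
    then have "(\<Sum>n. real m powr (- e) * w powr q * ?f (n + (m - 1)))
        \<le> (\<Sum>n. \<bar>mat_apply (gen_hilbert M) (c e) n\<bar> powr q)"
      by (intro suminf_le summable_mult tailsm smp csm e)
    also have "\<dots> \<le> L * S e"
      using bd[OF csm[OF e]] S1[OF e] unfolding cq S_def by simp
    finally have "real m powr (- e) * w powr q * (\<Sum>n. ?f (n + (m - 1))) \<le> L * S e"
      using suminf_mult[OF tailsm] by simp
    moreover have "real m powr (- e) * w powr q * (S e - real m) \<le> real m powr (- e) * w powr q * (\<Sum>n. ?f (n + (m - 1)))"
      using tail_ge by (intro mult_left_mono) auto
    ultimately have "real m powr (- e) * w powr q * (S e - real m) \<le> L * S e" by linarith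
    then show ?thesis using S1[OF e] by (simp add: field_simps)
  qed
  then have ev: "\<forall>\<^sub>F e in at_right 0. real m powr (- e) * w powr q * (1 - real m / S e) \<le> L"
    using eventually_at_right_less[of "0::real"] by (auto elim: eventually_mono)
  have "((\<lambda>e. real m / S e) \<longlongrightarrow> 0) (at_right 0)"
    using zeta_at_right_1 unfolding S_def
    by (intro tendsto_divide_0[OF tendsto_const] filterlim_at_top_imp_at_infinity)
  then have "((\<lambda>e. real m powr (- e) * w powr q * (1 - real m / S e)) \<longlongrightarrow> real m powr (- 0) * w powr q * (1 - 0)) (at_right 0)"
    using m by (intro tendsto_intros) auto
  then have "real m powr (- 0) * w powr q * (1 - 0) \<le> L"
    using ev by (rule tendsto_upperbound) simp
  then have "w powr q \<le> L" using m by simp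
  then have "(w powr q) powr (1 / q) \<le> L powr (1 / q)"
    using q by (intro powr_mono2) auto
  then have "w \<le> L powr (1 / q)" using q w by (simp add: powr_powr)
  then show ?thesis using w by (simp add: ennreal_leI)
qed

lemma weight_le_of_truncated:
  assumes "\<And>m. 0 < m \<Longrightarrow> (\<integral>\<^sup>+ t. ennreal (norm_density q t) * indicator {1 / real m..1 - 1 / real m} t \<partial>M) \<le> B"
  shows "(\<integral>\<^sup>+ t. ennreal (norm_density q t) \<partial>M) \<le> B"
proof -
  define f where "f m t = ennreal (norm_density q t) * indicator {1 / real (Suc m)..1 - 1 / real (Suc m)} t" for m t
  have "AE t in M. ennreal (norm_density q t) \<le> (SUP m. f m t)"
    using AE_interior
  proof eventually_elim
    case (elim t)
    then obtain m where m: "inverse (real (Suc m)) < min t (1 - t)"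
      using reals_Archimedean[of "min t (1 - t)"] by auto
    then have "ennreal (norm_density q t) = f m t"
      unfolding f_def by (simp add: divide_inverse)
    then show ?case by (metis SUP_upper UNIV_I)
  qed
  then have "(\<integral>\<^sup>+ t. ennreal (norm_density q t) \<partial>M) \<le> (\<integral>\<^sup>+ t. (SUP m. f m t) \<partial>M)"
    by (rule nn_integral_mono_AE)
  also have "\<dots> = (SUP m. \<integral>\<^sup>+ t. f m t \<partial>M)"
  proof (intro nn_integral_monotone_convergence_SUP incseq_SucI le_funI)
    fix m t
    have "1 / real (Suc (Suc m)) \<le> 1 / real (Suc m)" by (simp add: frac_le)
    then show "f m t \<le> f (Suc m) t"
      unfolding f_def by (intro mult_left_mono) (auto split: split_indicator)
  next
    show "f m \<in> borel_measurable M" for m unfolding f_def by measurable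
  qed
  also have "\<dots> \<le> B"
    unfolding f_def by (intro SUP_least assms) simp
  finally show ?thesis .
qed

end


section \<open>Both bounds for all exponents\<close>

lemma ell_norm_nonneg: "c \<in> ell p \<Longrightarrow> 0 \<le> ell_norm p c"
proof (cases "p = \<infinity>")
  case True
  assume "c \<in> ell p"
  then have "bdd_above (range (\<lambda>k. \<bar>c k\<bar>))"
    using True by (auto simp: ell_def bounded_iff)
  then have "\<bar>c 0\<bar> \<le> (SUP k. \<bar>c k\<bar>)"
    by (rule cSUP_upper[OF UNIV_I])
  then show ?thesis using True by (simp add: ell_norm_def)
qed (simp add: ell_norm_def)

lemma enn2real_exponent_ge_1:
  fixes p :: ennreal
  assumes "1 \<le> p" "p \<noteq> \<infinity>"
  shows "1 \<le> enn2real p"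
  using assms by (cases p) (auto simp flip: ennreal_1)

context interior_measure
begin

text \<open>
  For \<open>p = \<infinity>\<close> every row already carries the whole constant, so the norm is attained at the
  constant sequence 1.
\<close>

lemma suminf_row:
  "(\<Sum>k. ennreal (gen_hilbert M n k)) = (\<integral>\<^sup>+ t. ennreal (1 / (1 - t)) \<partial>M)"
proof -
  have "(\<Sum>k. ennreal (gen_hilbert M n k)) = (\<integral>\<^sup>+ t. (\<Sum>k. ennreal (kern n k t)) \<partial>M)"
    using nn_integral_row_apply[of "\<lambda>k. 1" n] by simp
  also have "\<dots> = (\<integral>\<^sup>+ t. ennreal (1 / (1 - t)) \<partial>M)"
    by (rule nn_integral_cong_AE, rule eventually_mono[OF AE_interior]) (auto simp: kern_row_suminf)
  finally show ?thesis .
qed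

lemma sup_norm_bound:
  assumes K: "0 \<le> K" and N: "(\<integral>\<^sup>+ t. ennreal (1 / (1 - t)) \<partial>M) \<le> ennreal K"
    and c: "\<And>k. \<bar>c k\<bar> \<le> B"
  shows "summable (\<lambda>k. gen_hilbert M n k * c k)"
    and "\<bar>mat_apply (gen_hilbert M) c n\<bar> \<le> K * B"
proof -
  have fin: "(\<Sum>k. ennreal (gen_hilbert M n k)) \<le> ennreal K"
    using N by (simp add: suminf_row)
  have A: "summable (gen_hilbert M n)"
    using fin by (intro summable_suminf_not_top) (auto simp: gen_hilbert_nonneg top_unique)
  have AK: "(\<Sum>k. gen_hilbert M n k) \<le> K"
    using fin K A by (simp add: suminf_ennreal2 gen_hilbert_nonneg)
  have le: "norm (gen_hilbert M n k * c k) \<le> gen_hilbert M n k * B" for k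
    using c[of k] by (simp add: abs_mult gen_hilbert_nonneg mult_left_mono)
  have B: "0 \<le> B" using c[of 0] by linarith
  show "summable (\<lambda>k. gen_hilbert M n k * c k)"
    by (rule summable_comparison_test'[OF summable_mult2[OF A, of B]]) (use le in auto)
  have "norm (\<Sum>k. gen_hilbert M n k * c k) \<le> (\<Sum>k. gen_hilbert M n k * B)"
    by (rule norm_suminf_le[OF le summable_mult2[OF A]])
  also have "\<dots> = (\<Sum>k. gen_hilbert M n k) * B"
    using A by (rule suminf_mult2[symmetric])
  also have "\<dots> \<le> K * B" using AK B by (rule mult_right_mono)
  finally show "\<bar>mat_apply (gen_hilbert M) c n\<bar> \<le> K * B"
    by (simp add: mat_apply_def)
qed

lemma gen_hilbert_upper_bound:
  assumes p: "1 \<le> p" and K: "0 < K" and N: "gen_hilbert_const M p \<le> ennreal K" and c: "c \<in> ell p"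
  shows "summable (\<lambda>k. gen_hilbert M n k * c k)"
    and "mat_apply (gen_hilbert M) c \<in> ell p"
    and "ell_norm p (mat_apply (gen_hilbert M) c) \<le> K * ell_norm p c"
proof -
  have "(\<forall>n. summable (\<lambda>k. gen_hilbert M n k * c k)) \<and> mat_apply (gen_hilbert M) c \<in> ell p
     \<and> ell_norm p (mat_apply (gen_hilbert M) c) \<le> K * ell_norm p c"
  proof (cases "p = \<infinity>")
    case True
    have bdd: "bdd_above (range (\<lambda>k. \<bar>c k\<bar>))"
      using True c by (auto simp: ell_def bounded_iff)
    have "\<bar>c k\<bar> \<le> (SUP k. \<bar>c k\<bar>)" for k
      using bdd by (rule cSUP_upper[OF UNIV_I])
    note sup_norm_bound[OF _ _ this, of K]
    moreover have "(\<integral>\<^sup>+ t. ennreal (1 / (1 - t)) \<partial>M) \<le> ennreal K"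
      using N True by (simp add: gen_hilbert_const_def)
    ultimately have *: "summable (\<lambda>k. gen_hilbert M n k * c k)"
      "\<bar>mat_apply (gen_hilbert M) c n\<bar> \<le> K * (SUP k. \<bar>c k\<bar>)" for n
      using K by auto
    then show ?thesis using True
      by (auto simp: ell_def ell_norm_def bounded_iff intro!: cSUP_least)
  next
    case False
    define q where "q = enn2real p"
    have q: "1 \<le> q" unfolding q_def using p False by (rule enn2real_exponent_ge_1)
    have cs: "summable (\<lambda>k. \<bar>c k\<bar> powr q)" using c False by (simp add: ell_def q_def)
    have N': "(\<integral>\<^sup>+ t. ennreal (norm_density q t) \<partial>M) \<le> ennreal K"
      using N False by (simp add: gen_hilbert_const_def norm_density_def q_def)
    note * = schur_test[OF q K N' cs]
    have "(\<Sum>n. \<bar>mat_apply (gen_hilbert M) c n\<bar> powr q) powr (1 / q)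
        \<le> (K powr q * (\<Sum>k. \<bar>c k\<bar> powr q)) powr (1 / q)"
      using q by (intro powr_mono2 *(3) suminf_nonneg *(2)) auto
    also have "\<dots> = K * (\<Sum>k. \<bar>c k\<bar> powr q) powr (1 / q)"
      using q K by (simp add: powr_mult powr_powr suminf_nonneg cs)
    finally show ?thesis using False *(1,2) by (simp add: ell_def ell_norm_def q_def)
  qed
  then show "summable (\<lambda>k. gen_hilbert M n k * c k)"
    and "mat_apply (gen_hilbert M) c \<in> ell p"
    and "ell_norm p (mat_apply (gen_hilbert M) c) \<le> K * ell_norm p c" by auto
qed

lemma gen_hilbert_lower_bound:
  assumes p: "1 \<le> p" and bdd: "ell_bounded p (gen_hilbert M)"
    and K: "\<And>c. c \<in> ell p \<Longrightarrow> 0 < ell_norm p c \<Longrightarrow> ell_norm p (mat_apply (gen_hilbert M) c) \<le> K * ell_norm p c"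
  shows "gen_hilbert_const M p \<le> ennreal K"
proof (cases "p = \<infinity>")
  case True
  let ?d = "mat_apply (gen_hilbert M) (\<lambda>_. 1)"
  have one: "(\<lambda>_. 1) \<in> ell p" "ell_norm p (\<lambda>_. 1) = 1"
    using True by (auto simp: ell_def ell_norm_def bounded_iff)
  have A: "summable (gen_hilbert M 0)" and d: "?d \<in> ell p"
    using bdd one by (auto simp: ell_bounded_def dest: bspec)
  have "bdd_above (range (\<lambda>k. \<bar>?d k\<bar>))"
    using d True by (auto simp: ell_def bounded_iff)
  then have "\<bar>?d 0\<bar> \<le> (SUP n. \<bar>?d n\<bar>)"
    by (rule cSUP_upper[OF UNIV_I])
  also have "\<dots> \<le> K" using K[OF one(1)] one(2) True by (simp add: ell_norm_def)
  finally have "(\<Sum>k. gen_hilbert M 0 k) \<le> K"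
    by (simp add: mat_apply_def)
  then have "(\<Sum>k. ennreal (gen_hilbert M 0 k)) \<le> ennreal K"
    using A by (simp add: suminf_ennreal2 gen_hilbert_nonneg ennreal_leI)
  then show ?thesis using True by (simp add: suminf_row gen_hilbert_const_def)
next
  case False
  define q where "q = enn2real p"
  have q: "1 \<le> q" unfolding q_def using p False by (rule enn2real_exponent_ge_1)
  have ell: "c \<in> ell p \<longleftrightarrow> summable (\<lambda>k. \<bar>c k\<bar> powr q)" for c
    using False by (simp add: ell_def q_def)
  have nrm: "ell_norm p c = (\<Sum>k. \<bar>c k\<bar> powr q) powr (1 / q)" for c
    using False by (simp add: ell_norm_def q_def)
  have img: "summable (\<lambda>k. gen_hilbert M n k * c k)" "mat_apply (gen_hilbert M) c \<in> ell p" if "c \<in> ell p" for c n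
    using bdd that by (auto simp: ell_bounded_def)
  have K0: "0 \<le> K"
  proof -
    define c :: "nat \<Rightarrow> real" where "c k = (if k = 0 then 1 else 0)" for k
    have "(\<lambda>k. \<bar>c k\<bar> powr q) = (\<lambda>k. if k = 0 then 1 else 0)" by (auto simp: c_def)
    then have sm: "(\<lambda>k. \<bar>c k\<bar> powr q) sums 1" using sums_single[of 0 "\<lambda>_. 1::real"] by simp
    then have c: "c \<in> ell p" "ell_norm p c = 1"
      by (auto simp: ell nrm sums_summable sums_unique[symmetric])
    show ?thesis using K[OF c(1)] c(2) ell_norm_nonneg[OF img(2)[OF c(1)]] by simp
  qed
  have "(\<integral>\<^sup>+ t. ennreal (norm_density q t) * indicator {1 / real m..1 - 1 / real m} t \<partial>M) \<le> ennreal ((K powr q) powr (1 / q))"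
    if "0 < m" for m
  proof (rule truncated_weight_le[OF q _ that])
    fix c :: "nat \<Rightarrow> real"
    assume c: "summable (\<lambda>k. \<bar>c k\<bar> powr q)"
    show "summable (\<lambda>k. gen_hilbert M n k * c k)" for n using c img ell by blast
    show dsm: "summable (\<lambda>n. \<bar>mat_apply (gen_hilbert M) c n\<bar> powr q)" using c img ell by blast
    assume pos: "0 < (\<Sum>k. \<bar>c k\<bar> powr q)"
    let ?D = "\<Sum>n. \<bar>mat_apply (gen_hilbert M) c n\<bar> powr q"
    have D: "0 \<le> ?D" by (intro suminf_nonneg dsm) auto
    have "?D powr (1 / q) \<le> K * (\<Sum>k. \<bar>c k\<bar> powr q) powr (1 / q)"
      using K[of c] c pos by (simp add: ell nrm)
    then have "(?D powr (1 / q)) powr q \<le> (K * (\<Sum>k. \<bar>c k\<bar> powr q) powr (1 / q)) powr q"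
      using q by (intro powr_mono2) auto
    then show "?D \<le> K powr q * (\<Sum>k. \<bar>c k\<bar> powr q)"
      using q K0 pos D by (simp add: powr_mult powr_powr)
  qed simp
  then have "(\<integral>\<^sup>+ t. ennreal (norm_density q t) \<partial>M) \<le> ennreal ((K powr q) powr (1 / q))"
    by (rule weight_le_of_truncated)
  then show ?thesis
    using False q K0 by (simp add: gen_hilbert_const_def norm_density_def q_def powr_powr)
qed

end

section \<open>Boundedness and the operator norm\<close>

theorem theorem2p1:
  fixes M :: "real measure" and p :: ennreal
  assumes "finite_measure M"
    and "sets M = sets (restrict_space borel {0..1})"
    and "1 \<le> p"
    and "emeasure M {0} = 0" and "emeasure M {1} = 0"
  shows "(ell_bounded p (gen_hilbert M) \<longleftrightarrow> gen_hilbert_const M p < \<infinity>) \<and>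
         (ell_bounded p (gen_hilbert M) \<longrightarrow>
            ennreal (ell_onorm p (gen_hilbert M)) = gen_hilbert_const M p)"
proof -
  interpret finite_measure M by fact
  interpret interior_measure M by unfold_locales fact+
  note p = \<open>1 \<le> p\<close>
  let ?A = "gen_hilbert M" and ?N = "gen_hilbert_const M p"
  let ?r = "\<lambda>c. ell_norm p (mat_apply ?A c) / ell_norm p c"
  have zero: "(\<lambda>_. 0) \<in> ell p" by (simp add: ell_def)
  have ratio: "?r c \<le> K" if "c \<in> ell p" "0 \<le> K" "0 < ell_norm p c \<Longrightarrow> ell_norm p (mat_apply ?A c) \<le> K * ell_norm p c" for c K
    using that ell_norm_nonneg[OF that(1)] by (cases "ell_norm p c = 0") (auto simp: divide_le_eq)
  have bounded_if: "ell_bounded p ?A" if "?N < \<infinity>"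
  proof -
    from that have "?N \<le> ennreal (enn2real ?N + 1)"
      by (cases ?N) (auto intro: ennreal_leI)
    with gen_hilbert_upper_bound[OF p, of "enn2real ?N + 1"] show ?thesis
      by (auto simp: ell_bounded_def add_nonneg_pos intro!: exI[of _ "enn2real ?N + 1"])
  qed
  have norm_eq: "?N < \<infinity> \<and> ennreal (ell_onorm p ?A) = ?N" if bdd: "ell_bounded p ?A"
  proof -
    obtain K where K: "\<And>c. c \<in> ell p \<Longrightarrow> ell_norm p (mat_apply ?A c) \<le> K * ell_norm p c"
      using bdd by (auto simp: ell_bounded_def)
    have fin: "?N < \<infinity>"
      using gen_hilbert_lower_bound[OF p bdd K] by (simp add: le_less_trans)
    have "?r c \<le> max K 0" if "c \<in> ell p" for c
      using that ell_norm_nonneg[OF that] K[OF that]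
      by (intro ratio) (auto intro: order_trans mult_right_mono)
    then have "bdd_above (?r ` ell p)" by (auto intro!: bdd_aboveI)
    then have "?r c \<le> ell_onorm p ?A" if "c \<in> ell p" for c
      unfolding ell_onorm_def using that by (intro cSUP_upper)
    then have "?N \<le> ennreal (ell_onorm p ?A)"
      by (intro gen_hilbert_lower_bound[OF p bdd]) (simp add: divide_le_eq)
    (* The upper bound needs K > 0, but the constant may vanish; hence the detour over e > 0. *)
    moreover have "ennreal (ell_onorm p ?A) \<le> ?N"
    proof (rule ennreal_le_epsilon)
      fix e :: real assume e: "0 < e"
      define L where "L = enn2real ?N + e"
      have L: "0 < L" "?N + ennreal e = ennreal L"
        using e fin by (simp_all add: L_def add_nonneg_pos)
      have "?N \<le> ennreal L" unfolding L(2)[symmetric] by simp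
      then have "ell_onorm p ?A \<le> L"
        unfolding ell_onorm_def using zero L(1) gen_hilbert_upper_bound(3)[OF p L(1)]
        by (intro cSUP_least ratio) auto
      then show "ennreal (ell_onorm p ?A) \<le> ?N + ennreal e"
        unfolding L(2) by (rule ennreal_leI)
    qed
    ultimately show ?thesis using fin by simp
  qed
  show ?thesis using bounded_if norm_eq by blast
qed

end
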